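(* Let $\alpha,\beta\in\mathbb{R}^2$. If $\beta\succ\alpha$, then $\mathcal{M}(D_\alpha,D_\beta)=\{0\}$.
   Context: $\mathbb{U}$ is the open unit disc in $\mathbb{C}$, $\mathbb{U}^2=\mathbb{U}\times\mathbb{U}$, and $\mathbb{Z}_+$ is the set of nonnegative integers. For $\alpha=(\alpha_1,\alpha_2)\in\mathbb{R}^2$, $D_\alpha$ is the space of functions $f(z,w)=\sum_{(k,l)\in\mathbb{Z}_+^2}a_{k,l}z^kw^l$ on $\mathbb{U}^2$ with $\sum_{(k,l)}|a_{k,l}|^2(k+1)^{\alpha_1}(l+1)^{\alpha_2}<\infty$. $\mathcal{M}(D_\alpha,D_\beta)$ is the set of functions $\phi:\mathbb{U}^2\to\mathbb{C}$ such that $\phi f\in D_\beta$ for all $f\in D_\alpha$. $\beta\succ\alpha$ means $\beta_1>\alpha_1$ and $\beta_2>\alpha_2$. *)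

theory Defs
  imports "HOL-Analysis.Analysis"
begin

definition bidisc :: "(complex \<times> complex) set" where
  "bidisc = ball 0 1 \<times> ball 0 1"

text \<open>
  Functions on the bidisc are represented by extensional functions, so that HOL equality of
  representatives is equality of functions on the bidisc.
  The weight condition makes the coefficients polynomially bounded, so the power series
  converges absolutely on the bidisc and unordered summation over index pairs loses nothing.
\<close>

definition D_space :: "real \<times> real \<Rightarrow> (complex \<times> complex \<Rightarrow> complex) set" where
  "D_space \<alpha> = {f \<in> bidisc \<rightarrow>\<^sub>E UNIV. \<exists>a :: nat \<times> nat \<Rightarrow> complex.
      (\<lambda>(k, l). (cmod (a (k, l)))\<^sup>2 * real (k + 1) powr fst \<alpha> * real (l + 1) powr snd \<alpha>)
        summable_on UNIV \<and>
      (\<forall>(z, w) \<in> bidisc. ((\<lambda>(k, l). a (k, l) * z ^ k * w ^ l) has_sum f (z, w)) UNIV)}"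

definition multipliers ::
  "real \<times> real \<Rightarrow> real \<times> real \<Rightarrow> (complex \<times> complex \<Rightarrow> complex) set" where
  "multipliers \<alpha> \<beta> =
     {\<phi> \<in> bidisc \<rightarrow>\<^sub>E UNIV. \<forall>f \<in> D_space \<alpha>. (\<lambda>p\<in>bidisc. \<phi> p * f p) \<in> D_space \<beta>}"

definition succ_both :: "real \<times> real \<Rightarrow> real \<times> real \<Rightarrow> bool" (infix "\<succ>" 50) where
  "\<beta> \<succ> \<alpha> \<longleftrightarrow> fst \<beta> > fst \<alpha> \<and> snd \<beta> > snd \<alpha>"

end

theory Submission
  imports Defs "HOL-Real_Asymp.Real_Asymp"
begin

text \<open>
  Every multiplier \<open>\<phi>\<close> is itself a function in \<open>D\<^sub>\<beta>\<close>, because the constant \<open>1\<close> lies in \<open>D\<^sub>\<alpha>\<close>; so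
  \<open>\<phi>\<close> has a power series with coefficients \<open>c\<close>. Suppose it is nonzero, and choose \<open>c (i, j) \<noteq> 0\<close> with
  \<open>i\<close> as small as possible. The idea is to test \<open>\<phi>\<close> on a function \<open>f (z, w) = (\<Sum>n. b n * (z * w) ^ n)\<close>
  that lies in \<open>D\<^sub>\<alpha>\<close> but barely misses having the weighted summability of \<open>D\<^sub>\<beta>\<close>.

  By minimality of \<open>i\<close>, the coefficient of \<open>\<phi> * f\<close> at \<open>(i + n, j + n)\<close> is \<open>c (i, j) * b n\<close> plus a sum
  that involves only \<open>b m\<close> with \<open>m < n\<close>. So the sign of \<open>b n\<close> can be chosen recursively in such a way
  that the new term does not cancel against the earlier ones
  (\<open>exists_convolution_no_cancellation\<close>): the coefficient then has modulus at least
  \<open>\<bar>c (i, j)\<bar> * \<bar>b n\<bar>\<close>. On this diagonal the weights of \<open>D\<^sub>\<beta>\<close> are bounded below by a constant times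
  \<open>(n + 1) powr (\<beta>\<^sub>1 + \<beta>\<^sub>2)\<close>, and those of \<open>D\<^sub>\<alpha>\<close> at \<open>(n, n)\<close> equal \<open>(n + 1) powr (\<alpha>\<^sub>1 + \<alpha>\<^sub>2)\<close>.
  With \<open>\<bar>b n\<bar>\<^sup>2 = (n + 1) powr - (\<beta>\<^sub>1 + \<beta>\<^sub>2 + 1)\<close> the weighted sum for \<open>f\<close> converges, since
  \<open>\<alpha>\<^sub>1 + \<alpha>\<^sub>2 < \<beta>\<^sub>1 + \<beta>\<^sub>2\<close>, while the one for \<open>\<phi> * f\<close> dominates a multiple of the harmonic series.
  Since the coefficients of \<open>\<phi> * f\<close> are determined by the function
  (\<open>double_powser_coeff_unique\<close>), this contradicts \<open>\<phi> * f \<in> D\<^sub>\<beta>\<close>.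
\<close>

section \<open>Double power series on the bidisc\<close>

text \<open>
  Once the coefficients below \<open>m\<close> vanish, dividing by \<open>x ^ m\<close> gives a power series that is zero on a
  punctured disc and tends to \<open>a m\<close> at the origin.
\<close>

lemma powser_sums_zero_imp_coeff_zero:
  fixes a :: "nat \<Rightarrow> 'a::{real_normed_field,banach}"
  assumes "0 < r" and sums: "\<And>x. norm x < r \<Longrightarrow> (\<lambda>n. a n * x ^ n) sums 0"
  shows "a m = 0"
proof (induction m rule: less_induct)
  case (less m)
  have "(\<lambda>n. a (n + m) * x ^ n) sums 0" if "x \<noteq> 0" "norm x < r" for x
  proof -
    have "(\<lambda>n. a (n + m) * x ^ (n + m)) sums 0"
      using sums_zero_iff_shift[of m "\<lambda>n. a n * x ^ n" 0] less sums[OF that(2)] by simp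
    then have "(\<lambda>n. x ^ m * (a (n + m) * x ^ n)) sums 0"
      by (simp add: power_add algebra_simps)
    then show ?thesis
      using sums_mult_D[of "x ^ m" _ 0] that by simp
  qed
  then have "((\<lambda>x. 0) \<longlongrightarrow> a (0 + m)) (at (0::'a))"
    by (rule powser_limit_0_strong[OF \<open>0 < r\<close>])
  then show "a m = 0"
    using tendsto_unique[OF _ _ tendsto_const, of "at (0::'a)"] by auto
qed

text \<open>
  The difference of the two series is, for fixed \<open>w\<close>, a power series in \<open>z\<close> whose coefficients are
  power series in \<open>w\<close>; uniqueness in one variable, applied first in \<open>z\<close> and then in \<open>w\<close>, kills it.
\<close>

lemma double_powser_coeff_unique:
  assumes a: "\<And>z w. (z, w) \<in> bidisc \<Longrightarrow> ((\<lambda>(k, l). a (k, l) * z ^ k * w ^ l) has_sum F (z, w)) UNIV"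
    and b: "\<And>z w. (z, w) \<in> bidisc \<Longrightarrow> ((\<lambda>(k, l). b (k, l) * z ^ k * w ^ l) has_sum F (z, w)) UNIV"
  shows "a = b"
proof
  fix p :: "nat \<times> nat"
  obtain k l where p: "p = (k, l)" by fastforce
  define d where "d p = a p - b p" for p
  have d: "((\<lambda>(k, l). d (k, l) * z ^ k * w ^ l) has_sum 0) (UNIV \<times> UNIV)"
    if "(z, w) \<in> bidisc" for z w
    using has_sum_add[OF a[OF that] has_sum_cmult_right[OF b[OF that], of "-1"]]
    by (simp add: d_def case_prod_unfold algebra_simps)
  \<comment> \<open>The rows are summable because the double series still converges at a point whose first
    coordinate is nonzero.\<close>
  have row_summable: "(\<lambda>l. d (k, l) * w ^ l) summable_on UNIV" if w: "norm w < 1" for k w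
  proof -
    have "(1/2, w) \<in> bidisc" using w by (simp add: bidisc_def)
    from has_sum_imp_summable[OF d[OF this]]
    have "(\<lambda>l. d (k, l) * (1/2) ^ k * w ^ l) summable_on UNIV"
      using summable_on_SigmaD1[of "\<lambda>k l. d (k, l) * (1/2) ^ k * w ^ l" UNIV "\<lambda>_. UNIV" k] by simp
    then have "(\<lambda>l. (1/2) ^ k * (d (k, l) * w ^ l)) summable_on UNIV"
      by (simp add: mult_ac)
    then show ?thesis
      by (subst (asm) summable_on_cmult_right') auto
  qed
  have row: "infsum (\<lambda>l. d (k, l) * w ^ l) UNIV = 0" if w: "norm w < 1" for k w
  proof (rule powser_sums_zero_imp_coeff_zero[where r = 1 and a = "\<lambda>k. infsum (\<lambda>l. d (k, l) * w ^ l) UNIV"])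
    fix z :: complex
    assume "norm z < 1"
    then have zw: "(z, w) \<in> bidisc" using w by (simp add: bidisc_def)
    have inner: "((\<lambda>l. d (k, l) * w ^ l * z ^ k) has_sum infsum (\<lambda>l. d (k, l) * w ^ l) UNIV * z ^ k) UNIV" for k
      by (intro has_sum_cmult_left has_sum_infsum row_summable w)
    have "((\<lambda>k. infsum (\<lambda>l. d (k, l) * w ^ l) UNIV * z ^ k) has_sum 0) UNIV"
      using has_sum_SigmaD[OF d[OF zw], of "\<lambda>k. infsum (\<lambda>l. d (k, l) * w ^ l) UNIV * z ^ k"] inner
      by (simp add: mult_ac)
    then show "(\<lambda>k. infsum (\<lambda>l. d (k, l) * w ^ l) UNIV * z ^ k) sums 0"
      by (rule has_sum_imp_sums)
  qed simp
  have "d (k, l) = 0"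
  proof (rule powser_sums_zero_imp_coeff_zero[where r = 1 and a = "\<lambda>l. d (k, l)"])
    fix w :: complex
    assume w: "norm w < 1"
    show "(\<lambda>l. d (k, l) * w ^ l) sums 0"
      using has_sum_imp_sums[OF has_sum_infsum[OF row_summable[OF w]]] row[OF w] by metis
  qed simp
  then show "a p = b p" by (simp add: d_def p)
qed

lemma has_sum_mult_complex:
  fixes f :: "'a \<Rightarrow> complex" and g :: "'b \<Rightarrow> complex"
  assumes f: "(f has_sum x) A" and g: "(g has_sum y) B"
  shows "((\<lambda>(a, b). f a * g b) has_sum x * y) (A \<times> B)"
proof (rule has_sum_SigmaI)
  show "((\<lambda>b. case (a, b) of (a, b) \<Rightarrow> f a * g b) has_sum f a * y) B" for a
    using g by (simp add: has_sum_cmult_right)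
  show "((\<lambda>a. f a * y) has_sum x * y) A"
    using f by (rule has_sum_cmult_left)
  have "(\<lambda>a. norm (f a)) summable_on A" "(\<lambda>b. norm (g b)) summable_on B"
    using has_sum_imp_summable[OF f] has_sum_imp_summable[OF g]
    by (simp_all add: summable_on_iff_abs_summable_on_complex)
  then have "(\<lambda>p. norm (case p of (a, b) \<Rightarrow> f a * g b)) summable_on A \<times> B"
    by (auto simp: Infinite_Sum.abs_summable_on_Sigma_iff norm_mult infsum_cmult_right' abs_mult
        intro: summable_on_cmult_right summable_on_cmult_left)
  then show "(\<lambda>(a, b). f a * g b) summable_on A \<times> B"
    by (simp add: summable_on_iff_abs_summable_on_complex)
qed

text \<open>
  A Cauchy product in which the second factor is a series in \<open>z * w\<close>, so that the convolution runs
  along diagonals. The triple series is absolutely convergent and may be regrouped by the total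
  exponents \<open>(p, q)\<close>.
\<close>

lemma has_sum_mult_diagonal_powser:
  fixes c :: "nat \<times> nat \<Rightarrow> complex"
  assumes c: "((\<lambda>(k, l). c (k, l) * z ^ k * w ^ l) has_sum x) UNIV"
    and b: "((\<lambda>n. b n * (z * w) ^ n) has_sum y) UNIV"
  shows "((\<lambda>(p, q). (\<Sum>n\<le>min p q. c (p - n, q - n) * b n) * z ^ p * w ^ q) has_sum x * y) UNIV"
proof -
  let ?h = "\<lambda>((p, q), n). c (p - n, q - n) * b n * z ^ p * w ^ q"
  have "((\<lambda>(r, n). (case r of (k, l) \<Rightarrow> c (k, l) * z ^ k * w ^ l) * (b n * (z * w) ^ n))
          has_sum x * y) (UNIV \<times> UNIV)"
    by (rule has_sum_mult_complex[OF c b])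
  also have "?this \<longleftrightarrow> (?h has_sum x * y) (SIGMA r:UNIV. {..min (fst r) (snd r)})"
    by (rule has_sum_reindex_bij_witness[where j = "\<lambda>((k, l), n). ((k + n, l + n), n)"
          and i = "\<lambda>((p, q), n). ((p - n, q - n), n)"])
       (auto simp: power_add power_mult_distrib)
  finally show ?thesis
    by (rule has_sum_SigmaD) (auto simp: sum_distrib_right)
qed

section \<open>The extremal diagonal series\<close>

text \<open>
  By the triangle inequality, of the two points \<open>s + t\<close> and \<open>s - t\<close> at least one has norm at least
  \<open>norm t\<close>. Hence, with \<open>s\<close> the contribution of the earlier entries, one of the two choices
  \<open>b n = r n\<close> and \<open>b n = - r n\<close> keeps the convolution as large as its leading term \<open>h 0 * b n\<close>.
\<close>

lemma exists_convolution_no_cancellation: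
  fixes h :: "nat \<Rightarrow> 'a::real_normed_field" and r :: "nat \<Rightarrow> real"
  assumes r: "\<And>n. 0 \<le> r n"
  obtains b where "\<And>n. norm (b n) = r n"
    and "\<And>n. norm (h 0) * r n \<le> norm (\<Sum>m\<le>n. h (n - m) * b m)"
proof -
  let ?P = "\<lambda>b n x. norm x = r n \<and> norm (h 0) * r n \<le> norm ((\<Sum>m<n. h (n - m) * b m) + h 0 * x)"
  have "\<exists>b. \<forall>n. ?P b n (b n)"
  proof (rule dependent_wellorder_choice)
    fix n :: nat and b :: "nat \<Rightarrow> 'a"
    let ?s = "\<Sum>m<n. h (n - m) * b m"
    let ?t = "h 0 * of_real (r n)"
    have t: "norm ?t = norm (h 0) * r n"
      using r[of n] by (simp add: norm_mult)
    have "norm (2 * ?t) \<le> norm (?s + ?t) + norm (?s + - ?t)"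
      using norm_triangle_ineq4[of "?s + ?t" "?s + - ?t"] by (simp add: algebra_simps)
    moreover have "norm (2 * ?t) = 2 * norm ?t"
      by (simp add: norm_mult)
    ultimately have "norm ?t \<le> norm (?s + ?t) \<or> norm ?t \<le> norm (?s + - ?t)"
      by linarith
    then have "?P b n (of_real (r n)) \<or> ?P b n (- of_real (r n))"
      using t r[of n] by auto
    then show "\<exists>x. ?P b n x" by blast
  next
    fix x :: 'a and b g :: "nat \<Rightarrow> 'a" and n
    assume "\<And>y. y < n \<Longrightarrow> b y = g y"
    then have "(\<Sum>m<n. h (n - m) * b m) = (\<Sum>m<n. h (n - m) * g m)"
      by (intro sum.cong) auto
    then show "?P b n x = ?P g n x" by simp
  qed
  then obtain b where b: "\<And>n. ?P b n (b n)" by blast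
  show ?thesis
  proof
    show "norm (b n) = r n" for n using b by blast
    have "(\<Sum>m\<le>n. h (n - m) * b m) = (\<Sum>m<n. h (n - m) * b m) + h 0 * b n" for n
      by (simp add: lessThan_Suc_atMost[symmetric])
    then show "norm (h 0) * r n \<le> norm (\<Sum>m\<le>n. h (n - m) * b m)" for n
      using b[of n] by simp
  qed
qed

lemma powser_summable_of_polynomial_growth:
  fixes b :: "nat \<Rightarrow> complex"
  assumes b: "\<And>n. norm (b n) = real (n + 1) powr s" and x: "norm x < 1"
  shows "(\<lambda>n. b n * x ^ n) summable_on UNIV"
proof (rule norm_summable_imp_summable_on)
  show "summable (\<lambda>n. norm (b n * x ^ n))"
  proof (cases "x = 0")
    case True
    have "summable (\<lambda>n. norm (b n) * 0 ^ n)" by (rule summable_zero_power')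
    then show ?thesis using True by (simp add: norm_mult norm_power)
  next
    case False
    define t where "t = norm x"
    have t: "0 < t" "t < 1" using False x by (auto simp: t_def)
    have "summable (\<lambda>n. real (n + 1) powr s * t ^ n)"
    proof (rule summable_comparison_test_bigo)
      show "summable (\<lambda>n. norm (real n powr -2))"
        by (simp add: summable_real_powr_iff)
      show "(\<lambda>n. real (n + 1) powr s * t ^ n) \<in> O(\<lambda>n. real n powr -2)"
        using t by real_asymp
    qed
    then show ?thesis using b by (simp add: norm_mult norm_power t_def)
  qed
qed

lemma diagonal_series_in_D_space:
  assumes b: "\<And>x. norm x < 1 \<Longrightarrow> (\<lambda>n. b n * x ^ n) summable_on UNIV"
    and w: "summable (\<lambda>n. (cmod (b n))\<^sup>2 * real (n + 1) powr (fst \<alpha> + snd \<alpha>))"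
  shows "(\<lambda>(z, w)\<in>bidisc. \<Sum>\<^sub>\<infinity>n. b n * (z * w) ^ n) \<in> D_space \<alpha>"
proof -
  define a where "a = (\<lambda>(k, l). if k = l then b k else 0)"
  have diag: "(g has_sum s) UNIV \<longleftrightarrow> ((\<lambda>n. g (n, n)) has_sum s) UNIV"
    if "\<And>k l. k \<noteq> l \<Longrightarrow> g (k, l) = 0" for g :: "nat \<times> nat \<Rightarrow> 'c::{comm_monoid_add,topological_space}" and s
  proof -
    have "(g has_sum s) UNIV \<longleftrightarrow> (g has_sum s) (range (\<lambda>n. (n, n)))"
      by (rule has_sum_cong_neutral) (use that in auto)
    also have "\<dots> \<longleftrightarrow> ((\<lambda>n. g (n, n)) has_sum s) UNIV"
      by (subst has_sum_reindex) (auto simp: inj_on_def o_def)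
    finally show ?thesis .
  qed
  have "(\<lambda>n. (cmod (b n))\<^sup>2 * real (n + 1) powr (fst \<alpha> + snd \<alpha>)) summable_on UNIV"
    by (rule summable_nonneg_imp_summable_on[OF w]) simp
  then have "(\<lambda>(k, l). (cmod (a (k, l)))\<^sup>2 * real (k + 1) powr fst \<alpha> * real (l + 1) powr snd \<alpha>)
      summable_on UNIV"
    unfolding summable_on_def by (subst diag) (auto simp: a_def powr_add mult_ac)
  moreover have "((\<lambda>(k, l). a (k, l) * z ^ k * w ^ l) has_sum (\<Sum>\<^sub>\<infinity>n. b n * (z * w) ^ n)) UNIV"
    if "(z, w) \<in> bidisc" for z w
  proof -
    have "norm (z * w) < 1"
      using that mult_strict_mono[of "norm z" 1 "norm w" 1] by (auto simp: bidisc_def norm_mult)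
    from has_sum_infsum[OF b[OF this]] show ?thesis
      by (subst diag) (auto simp: a_def power_mult_distrib mult_ac)
  qed
  ultimately show ?thesis
    unfolding D_space_def by (auto intro!: exI[of _ a])
qed

text \<open>
  For \<open>p < 0\<close> the bound comes from \<open>i + n + 1 \<le> (i + 1) * (n + 1)\<close>.
\<close>

lemma shifted_weight_lower_bound:
  obtains K where "0 < K" "\<And>n. K * real (n + 1) powr p \<le> real (i + n + 1) powr p"
proof (cases "0 \<le> p")
  case True
  show ?thesis
    by (rule that[of 1]) (use True in \<open>auto intro!: powr_mono2\<close>)
next
  case False
  have "real (i + 1) powr p * real (n + 1) powr p \<le> real (i + n + 1) powr p" for n
  proof -
    have "real (i + n + 1) \<le> real (i + 1) * real (n + 1)"
      by (simp add: algebra_simps)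
    then have "(real (i + 1) * real (n + 1)) powr p \<le> real (i + n + 1) powr p"
      using False by (intro powr_mono2') auto
    then show ?thesis by (simp add: powr_mult)
  qed
  then show ?thesis
    by (intro that[of "real (i + 1) powr p"]) auto
qed

section \<open>Multipliers into a smaller space\<close>

text \<open>
  Functions of \<open>z * w\<close> see the weights only on the diagonal, where the two exponents add up; this
  is why the comparison of the exponent sums decides. Induction on \<open>i\<close> plays the role of choosing
  a nonzero coefficient with minimal first index.
\<close>

lemma multiplier_coeffs_zero:
  assumes lt: "fst \<alpha> + snd \<alpha> < fst \<beta> + snd \<beta>"
    and \<phi>: "\<phi> \<in> multipliers \<alpha> \<beta>"
    and c: "\<And>z w. (z, w) \<in> bidisc \<Longrightarrow> ((\<lambda>(k, l). c (k, l) * z ^ k * w ^ l) has_sum \<phi> (z, w)) UNIV"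
  shows "c (i, j) = 0"
proof (induction i arbitrary: j rule: less_induct)
  case (less i)
  show ?case
  proof (rule ccontr)
    assume nz: "c (i, j) \<noteq> 0"
    \<comment> \<open>The exponent for which \<open>\<bar>b n\<bar>\<^sup>2 * (n + 1) powr (\<beta>\<^sub>1 + \<beta>\<^sub>2)\<close> is exactly \<open>1 / (n + 1)\<close>.\<close>
    define s where "s = - (fst \<beta> + snd \<beta> + 1) / 2"
    obtain b where b: "\<And>n. norm (b n) = real (n + 1) powr s"
      and big: "\<And>n. norm (c (i, j)) * real (n + 1) powr s
        \<le> norm (\<Sum>m\<le>n. c (i + (n - m), j + (n - m)) * b m)"
      using exists_convolution_no_cancellation[of "\<lambda>n. real (n + 1) powr s" "\<lambda>m. c (i + m, j + m)"]
      by auto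
    have sq: "(real (n + 1) powr s)\<^sup>2 * real (n + 1) powr q = real (n + 1) powr (q + 2 * s)" for n q
      by (simp add: power2_eq_square powr_add[symmetric] algebra_simps)
    define f where "f = (\<lambda>(z, w)\<in>bidisc. \<Sum>\<^sub>\<infinity>n. b n * (z * w) ^ n)"
    have conv: "(\<lambda>n. b n * x ^ n) summable_on UNIV" if "norm x < 1" for x
      using powser_summable_of_polynomial_growth[OF b that] .
    have "fst \<alpha> + snd \<alpha> + 2 * s < -1" using lt by (simp add: s_def field_simps)
    then have "summable (\<lambda>n. real (Suc n) powr (fst \<alpha> + snd \<alpha> + 2 * s))"
      by (subst summable_Suc_iff) (simp add: summable_real_powr_iff)
    then have "f \<in> D_space \<alpha>"
      unfolding f_def by (intro diagonal_series_in_D_space conv) (simp_all only: b sq Suc_eq_plus1)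
    then have "(\<lambda>p\<in>bidisc. \<phi> p * f p) \<in> D_space \<beta>"
      using \<phi> by (simp add: multipliers_def)
    then obtain d where d: "(\<lambda>(k, l). (cmod (d (k, l)))\<^sup>2 * real (k + 1) powr fst \<beta> * real (l + 1) powr snd \<beta>)
          summable_on UNIV"
      and dsum: "\<forall>(z, w) \<in> bidisc. ((\<lambda>(k, l). d (k, l) * z ^ k * w ^ l) has_sum
          (\<lambda>p\<in>bidisc. \<phi> p * f p) (z, w)) UNIV"
      by (auto simp: D_space_def)
    have "d = (\<lambda>(p, q). \<Sum>n\<le>min p q. c (p - n, q - n) * b n)"
    proof (rule double_powser_coeff_unique[where F = "\<lambda>p. \<phi> p * f p"])
      fix z w :: complex
      assume zw: "(z, w) \<in> bidisc"
      show "((\<lambda>(k, l). d (k, l) * z ^ k * w ^ l) has_sum \<phi> (z, w) * f (z, w)) UNIV"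
        using dsum zw by auto
      have "norm (z * w) < 1"
        using zw mult_strict_mono[of "norm z" 1 "norm w" 1] by (auto simp: bidisc_def norm_mult)
      then have "((\<lambda>n. b n * (z * w) ^ n) has_sum f (z, w)) UNIV"
        using zw by (simp add: f_def conv has_sum_infsum)
      from has_sum_mult_diagonal_powser[OF c[OF zw] this]
      show "((\<lambda>(k, l). (case (k, l) of (p, q) \<Rightarrow> \<Sum>n\<le>min p q. c (p - n, q - n) * b n) * z ^ k * w ^ l)
          has_sum \<phi> (z, w) * f (z, w)) UNIV"
        by simp
    qed
    then have "d (i + n, j + n) = (\<Sum>m\<le>n. c (i + (n - m), j + (n - m)) * b m)" for n
    proof -
      have "(\<Sum>m\<le>n. c (i + (n - m), j + (n - m)) * b m) = (\<Sum>m\<le>n. c (i + n - m, j + n - m) * b m)"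
        by (rule sum.cong) auto
      \<comment> \<open>The terms with \<open>m > n\<close> vanish by the induction hypothesis: their first index is below \<open>i\<close>.\<close>
      also have "\<dots> = (\<Sum>m\<le>min (i + n) (j + n). c (i + n - m, j + n - m) * b m)"
        by (rule sum.mono_neutral_left) (auto intro!: less)
      finally show ?thesis
        using \<open>d = _\<close> by simp
    qed
    then have d_big: "norm (c (i, j)) * real (n + 1) powr s \<le> norm (d (i + n, j + n))" for n
      using big by simp
    obtain K where K: "0 < K" "\<And>n. K * real (n + 1) powr fst \<beta> \<le> real (i + n + 1) powr fst \<beta>"
      using shifted_weight_lower_bound[of "fst \<beta>" i] by blast
    obtain L where L: "0 < L" "\<And>n. L * real (n + 1) powr snd \<beta> \<le> real (j + n + 1) powr snd \<beta>"
      using shifted_weight_lower_bound[of "snd \<beta>" j] by blast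
    have exponent: "fst \<beta> + snd \<beta> + 2 * s = -1" by (simp add: s_def field_simps)
    define C where "C = (norm (c (i, j)))\<^sup>2 * K * L"
    have "C > 0" using nz K L by (simp add: C_def)
    have "(\<lambda>n. (cmod (d (i + n, j + n)))\<^sup>2 * real (i + n + 1) powr fst \<beta> * real (j + n + 1) powr snd \<beta>)
        summable_on UNIV"
    proof -
      have "(\<lambda>(k, l). (cmod (d (k, l)))\<^sup>2 * real (k + 1) powr fst \<beta> * real (l + 1) powr snd \<beta>)
          summable_on range (\<lambda>n. (i + n, j + n))"
        by (rule summable_on_subset_banach[OF d]) simp
      then show ?thesis
        by (subst (asm) summable_on_reindex) (auto simp: inj_on_def o_def)
    qed
    then have "(\<lambda>n. C * inverse (real (n + 1))) summable_on UNIV"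
    proof (rule summable_on_comparison_test)
      fix n :: nat
      have "C * inverse (real (n + 1)) = C * ((real (n + 1) powr s)\<^sup>2 * real (n + 1) powr (fst \<beta> + snd \<beta>))"
        unfolding sq by (simp add: exponent powr_minus)
      also have "\<dots> = (norm (c (i, j)) * real (n + 1) powr s)\<^sup>2
          * (K * real (n + 1) powr fst \<beta>) * (L * real (n + 1) powr snd \<beta>)"
        by (simp add: C_def powr_add power_mult_distrib mult_ac)
      also have "\<dots> \<le> (cmod (d (i + n, j + n)))\<^sup>2 * real (i + n + 1) powr fst \<beta> * real (j + n + 1) powr snd \<beta>"
        by (intro mult_mono power_mono d_big K(2) L(2)) (use K(1) L(1) in auto)
      finally show "C * inverse (real (n + 1)) \<le> \<dots>" .
    qed (use \<open>C > 0\<close> in auto)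
    then have "summable (\<lambda>n. C * inverse (real (n + 1)))"
      using summable_on_imp_summable by blast
    then have "summable (\<lambda>n. inverse (real (Suc n)))"
      using \<open>C > 0\<close> by (simp add: summable_cmult_iff)
    then show False
      using not_summable_harmonic[where 'a = real] summable_Suc_iff[of "\<lambda>n. inverse (real n)"] by simp
  qed
qed

theorem theorem3p13:
  fixes \<alpha> \<beta> :: "real \<times> real"
  assumes "\<beta> \<succ> \<alpha>"
  shows "multipliers \<alpha> \<beta> = {\<lambda>p\<in>bidisc. 0}"
proof (intro equalityI subsetI)
  fix \<phi>
  assume \<phi>: "\<phi> \<in> multipliers \<alpha> \<beta>"
  \<comment> \<open>Applying the multiplier to the constant function \<open>1\<close> shows that it has a power series.\<close>
  have one: "(\<lambda>p\<in>bidisc. 1) \<in> D_space \<alpha>"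
  proof -
    have z: "((\<lambda>n. (if n = 0 then 1 else 0) * x ^ n) has_sum 1) UNIV" for x :: complex
      using has_sum_finite_neutralI[of "{0::nat}" UNIV "\<lambda>n. (if n = 0 then 1 else 0) * x ^ n" 1] by auto
    have "(\<lambda>(z, w)\<in>bidisc. \<Sum>\<^sub>\<infinity>n. (if n = 0 then 1 else 0) * (z * w) ^ n) \<in> D_space \<alpha>"
      by (rule diagonal_series_in_D_space)
         (use z in \<open>auto intro: has_sum_imp_summable intro!: summable_finite[of "{0}"] split: if_splits\<close>)
    then show ?thesis using infsumI[OF z] by (simp add: case_prod_unfold)
  qed
  have ext: "\<phi> \<in> bidisc \<rightarrow>\<^sub>E UNIV" using \<phi> by (simp add: multipliers_def)
  have "(\<lambda>p\<in>bidisc. \<phi> p * (\<lambda>p\<in>bidisc. 1) p) \<in> D_space \<beta>"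
    using \<phi> one unfolding multipliers_def by blast
  then obtain c where c: "\<forall>(z, w) \<in> bidisc. ((\<lambda>(k, l). c (k, l) * z ^ k * w ^ l) has_sum
      (\<lambda>p\<in>bidisc. \<phi> p * (\<lambda>p\<in>bidisc. 1) p) (z, w)) UNIV"
    unfolding D_space_def by blast
  have c': "((\<lambda>(k, l). c (k, l) * z ^ k * w ^ l) has_sum \<phi> (z, w)) UNIV" if "(z, w) \<in> bidisc" for z w
    using c that by auto
  have "c (k, l) = 0" for k l
    using multiplier_coeffs_zero[OF _ \<phi> c'] assms by (simp add: succ_both_def)
  then have "\<phi> (z, w) = 0" if "(z, w) \<in> bidisc" for z w
    by (intro has_sum_unique[OF c'[OF that] has_sum_0]) auto
  then have "\<phi> = (\<lambda>p\<in>bidisc. 0)"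
    using ext by (intro extensionalityI[of _ bidisc]) (auto simp: PiE_def)
  then show "\<phi> \<in> {\<lambda>p\<in>bidisc. 0}" by simp
next
  fix \<phi> :: "complex \<times> complex \<Rightarrow> complex"
  assume "\<phi> \<in> {\<lambda>p\<in>bidisc. 0}"
  then have \<phi>: "\<phi> = (\<lambda>p\<in>bidisc. 0)" by simp
  have "(\<lambda>p\<in>bidisc. 0) \<in> D_space \<beta>"
    using diagonal_series_in_D_space[of "\<lambda>_. 0" \<beta>] by (simp add: case_prod_unfold)
  then show "\<phi> \<in> multipliers \<alpha> \<beta>"
    by (simp add: \<phi> multipliers_def cong: restrict_cong)
qed

end
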